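(* Let $C:I\to H_3$ be a smooth curve in the Heisenberg manifold $(H_3,g)$, where $I\subseteq\mathbb{R}$ is an open interval containing $0$, and let $u,v,w\in\mathbb{R}$. (i) Let $\widetilde{C}$ be a horizontal lift of $C$ to $TH_3$ with $\widetilde{C}(0)=(0,0,0,0,0,0)$ and $\dot{\widetilde{C}}(0)=(u,v,w,0,0,0)$. Then $\widetilde{C}$ is a geodesic of $(TH_3,g^s)$ if and only if $C$ is a geodesic of $(H_3,g)$. (ii) Let $\widehat{C}$ be the natural lift of $C$ to $TH_3$, and suppose $\widehat{C}(0)=(0,0,0,0,0,0)$ and $\dot{\widehat{C}}(0)=(u,v,w,0,0,0)$. Then $\widehat{C}$ is a geodesic of $(TH_3,g^s)$ if and only if $C$ is a geodesic of $(H_3,g)$.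
   Context: The Heisenberg manifold $(H_3,g)$ is $\mathbb{R}^3$ with coordinates $(x^1,x^2,x^3)$ and metric $g=(dx^1)^2+(dx^2)^2+(dx^3+x^2dx^1-x^1dx^2)^2$. The tangent bundle $TH_3$ has induced coordinates $(x^1,x^2,x^3,y^1,y^2,y^3)$, where $y^i$ are the components of a tangent vector $y^i\frac{\partial}{\partial x^i}$. Points of $TH_3$ and velocities of curves in $TH_3$ are written in these coordinates. The Sasaki metric on $TH_3$ is $$g^s=(dx^1)^2+(dx^2)^2+(dx^3+x^2dx^1-x^1dx^2)^2+(Dy^1)^2+(Dy^2)^2+(Dy^3+x^2Dy^1-x^1Dy^2)^2,$$ where $Dy^i=dy^i+\Gamma^i_{hj}y^h\,dx^j$ and $\Gamma^i_{hj}$ are the Christoffel symbols of $g$. Given a curve $C(t)=(x^1(t),x^2(t),x^3(t))$ in $H_3$ and a vector field $X=X^j(t)\frac{\partial}{\partial x^j}$ along $C$, one considers the curve $t\mapsto(x^1(t),x^2(t),x^3(t),X^1(t),X^2(t),X^3(t))$ in $TH_3$. It is called a horizontal lift of $C$ if $X$ is parallel along $C$ (with respect to the Levi-Civita connection of $g$), and it is called the natural lift of $C$ if $X=\frac{dC}{dt}$ is the tangent vector field of $C$. *)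

theory Defs
  imports "HOL-Analysis.Analysis"
begin

section \<open>Riemannian geometry in one global chart\<close>

text \<open>
  All manifolds here have a single global chart, so a metric is a family of bilinear forms
  \<open>g p v w\<close> on \<open>real ^ 'n\<close>, where \<open>p\<close> is the base point and \<open>v\<close>, \<open>w\<close> are tangent vectors in
  coordinates.
\<close>

type_synonym 'n metric = "real ^ 'n \<Rightarrow> real ^ 'n \<Rightarrow> real ^ 'n \<Rightarrow> real"

definition metric_matrix :: "'n::finite metric \<Rightarrow> real ^ 'n \<Rightarrow> real ^ 'n ^ 'n" where
  "metric_matrix g p = (\<chi> i j. g p (axis i 1) (axis j 1))"

definition partial_deriv :: "'n::finite \<Rightarrow> (real ^ 'n \<Rightarrow> real) \<Rightarrow> real ^ 'n \<Rightarrow> real" where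
  "partial_deriv k f p = deriv (\<lambda>s. f (p + s *\<^sub>R axis k 1)) 0"

text \<open>\<open>christoffel g p i h j\<close> has upper index \<open>i\<close> and lower indices \<open>h\<close>, \<open>j\<close>.\<close>

definition christoffel :: "'n::finite metric \<Rightarrow> real ^ 'n \<Rightarrow> 'n \<Rightarrow> 'n \<Rightarrow> 'n \<Rightarrow> real" where
  "christoffel g p i h j =
     (1 / 2) * (\<Sum>k\<in>UNIV. matrix_inv (metric_matrix g p) $ i $ k *
       (partial_deriv h (\<lambda>q. metric_matrix g q $ k $ j) p
        + partial_deriv j (\<lambda>q. metric_matrix g q $ k $ h) p
        - partial_deriv k (\<lambda>q. metric_matrix g q $ h $ j) p))"

definition velocity :: "(real \<Rightarrow> 'a::real_normed_vector) \<Rightarrow> real \<Rightarrow> 'a" where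
  "velocity c t = vector_derivative c (at t)"

text \<open>Used for open \<open>I\<close> only, so that the two-sided derivatives depend only on \<open>c\<close> on \<open>I\<close>.\<close>

definition smooth_curve_on :: "real set \<Rightarrow> (real \<Rightarrow> 'a::real_normed_vector) \<Rightarrow> bool" where
  "smooth_curve_on I c \<longleftrightarrow> (\<forall>k. \<forall>t\<in>I. (velocity ^^ k) c differentiable (at t))"

definition covariant_deriv ::
  "'n::finite metric \<Rightarrow> (real \<Rightarrow> real ^ 'n) \<Rightarrow> (real \<Rightarrow> real ^ 'n) \<Rightarrow> real \<Rightarrow> real ^ 'n" where
  "covariant_deriv g c X t =
     (\<chi> i. velocity X t $ i
        + (\<Sum>h\<in>UNIV. \<Sum>j\<in>UNIV. christoffel g (c t) i h j * X t $ h * velocity c t $ j))"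

definition parallel_along ::
  "'n::finite metric \<Rightarrow> real set \<Rightarrow> (real \<Rightarrow> real ^ 'n) \<Rightarrow> (real \<Rightarrow> real ^ 'n) \<Rightarrow> bool" where
  "parallel_along g I c X \<longleftrightarrow>
     (\<forall>t\<in>I. X differentiable (at t) \<and> covariant_deriv g c X t = 0)"

text \<open>Geodesics are affinely parametrised; constant curves are included.\<close>

definition geodesic_on :: "'n::finite metric \<Rightarrow> real set \<Rightarrow> (real \<Rightarrow> real ^ 'n) \<Rightarrow> bool" where
  "geodesic_on g I c \<longleftrightarrow> smooth_curve_on I c \<and> parallel_along g I c (velocity c)"


section \<open>The tangent bundle and the Sasaki metric\<close>

text \<open>
  The induced coordinates on the tangent bundle are indexed by \<open>'n + 'n\<close>: \<open>Inl i\<close> is the index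
  of \<open>x\<^sup>i\<close> and \<open>Inr i\<close> is the index of \<open>y\<^sup>i\<close>. The same splitting is used for tangent vectors of
  the bundle, whose two parts are then their \<open>dx\<^sup>i\<close> and \<open>dy\<^sup>i\<close> components.
\<close>

definition bundle_pair :: "real ^ 'n::finite \<Rightarrow> real ^ 'n \<Rightarrow> real ^ ('n + 'n)" where
  "bundle_pair x y = (\<chi> k. case k of Inl i \<Rightarrow> x $ i | Inr i \<Rightarrow> y $ i)"

definition base_part :: "real ^ ('n::finite + 'n) \<Rightarrow> real ^ 'n" where
  "base_part p = (\<chi> i. p $ Inl i)"

definition fibre_part :: "real ^ ('n::finite + 'n) \<Rightarrow> real ^ 'n" where
  "fibre_part p = (\<chi> i. p $ Inr i)"

text \<open>The values on \<open>V\<close> of the one-forms \<open>Dy\<^sup>i = dy\<^sup>i + \<Gamma>\<^sup>i\<^sub>h\<^sub>j y\<^sup>h dx\<^sup>j\<close> at the point \<open>p\<close>.\<close>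

definition connection_form ::
  "'n::finite metric \<Rightarrow> real ^ ('n + 'n) \<Rightarrow> real ^ ('n + 'n) \<Rightarrow> real ^ 'n" where
  "connection_form g p V =
     (\<chi> i. fibre_part V $ i
        + (\<Sum>h\<in>UNIV. \<Sum>j\<in>UNIV.
             christoffel g (base_part p) i h j * fibre_part p $ h * base_part V $ j))"

definition sasaki_metric :: "'n::finite metric \<Rightarrow> ('n + 'n) metric" where
  "sasaki_metric g p V W =
     g (base_part p) (base_part V) (base_part W)
     + g (base_part p) (connection_form g p V) (connection_form g p W)"

definition horizontal_lift ::
  "'n::finite metric \<Rightarrow> real set \<Rightarrow> (real \<Rightarrow> real ^ 'n) \<Rightarrow> (real \<Rightarrow> real ^ ('n + 'n)) \<Rightarrow> bool" where
  "horizontal_lift g I C L \<longleftrightarrow>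
     (\<exists>X. parallel_along g I C X \<and> (\<forall>t\<in>I. L t = bundle_pair (C t) (X t)))"

definition natural_lift :: "(real \<Rightarrow> real ^ 'n::finite) \<Rightarrow> real \<Rightarrow> real ^ ('n + 'n)" where
  "natural_lift C t = bundle_pair (C t) (velocity C t)"


section \<open>The Heisenberg manifold\<close>

text \<open>The one-form \<open>dx\<^sup>3 + x\<^sup>2 dx\<^sup>1 - x\<^sup>1 dx\<^sup>2\<close>; superscripts are coordinate indices.\<close>

definition heisenberg_form :: "real ^ 3 \<Rightarrow> real ^ 3 \<Rightarrow> real" where
  "heisenberg_form x v = v $ 3 + x $ 2 * v $ 1 - x $ 1 * v $ 2"

definition heisenberg_metric :: "3 metric" where
  "heisenberg_metric x v w =
     v $ 1 * w $ 1 + v $ 2 * w $ 2 + heisenberg_form x v * heisenberg_form x w"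

lemma sasaki_heisenberg_quadratic:
  fixes p V :: "real ^ (3 + 3)"
  defines "x \<equiv> base_part p" and "dx \<equiv> base_part V"
    and "Dy \<equiv> connection_form heisenberg_metric p V"
  shows "sasaki_metric heisenberg_metric p V V =
    (dx $ 1)\<^sup>2 + (dx $ 2)\<^sup>2 + (dx $ 3 + x $ 2 * dx $ 1 - x $ 1 * dx $ 2)\<^sup>2
    + (Dy $ 1)\<^sup>2 + (Dy $ 2)\<^sup>2 + (Dy $ 3 + x $ 2 * Dy $ 1 - x $ 1 * Dy $ 2)\<^sup>2"
  unfolding assms
  by (simp add: sasaki_metric_def heisenberg_metric_def heisenberg_form_def power2_eq_square)

end

theory Submission
  imports Defs
begin

text \<open>
  Parallel transport preserves the norm, so a parallel field that vanishes at one point vanishes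
  along the whole curve. Hence in (i) the lift is the curve \<open>(C, 0)\<close> in the zero section, and the
  zero section is totally geodesic: at \<open>y = 0\<close> the Sasaki metric is block diagonal with two copies
  of \<open>g\<close>, and its base block depends on \<open>y\<close> only to second order.

  In (ii) the initial conditions give \<open>C'(0) = 0\<close> and zero initial velocity of the natural
  lift. If either curve is a geodesic, its velocity is parallel along it and so vanishes identically.
  Then \<open>C\<close> is constant and its natural lift again lies in the zero section, which reduces (ii) to
  (i).
\<close>

section \<open>Matrix inverses and derivatives along curves\<close>

lemma matrix_inv_mul:
  fixes A :: "'a::semiring_1^'n^'m"
  assumes "invertible A"
  shows "A ** matrix_inv A = mat 1" "matrix_inv A ** A = mat 1"
proof -
  have "A ** matrix_inv A = mat 1 \<and> matrix_inv A ** A = mat 1"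
    using assms unfolding invertible_def matrix_inv_def by (rule someI_ex)
  then show "A ** matrix_inv A = mat 1" "matrix_inv A ** A = mat 1" by auto
qed

lemma matrix_inv_unique:
  fixes A B :: "'a::field^'n^'n"
  assumes "A ** B = mat 1"
  shows "matrix_inv A = B"
proof -
  have "B ** A = mat 1" using assms by (simp add: matrix_left_right_inverse)
  then have "invertible A" using assms by (auto simp: invertible_def)
  then have "matrix_inv A ** A ** B = B" by (simp add: matrix_inv_mul(2))
  then show ?thesis using assms by (simp add: matrix_mul_assoc[symmetric])
qed

lemma sum_UNIV_sum_type:
  fixes f :: "'a::finite + 'b::finite \<Rightarrow> 'c::comm_monoid_add"
  shows "(\<Sum>k\<in>UNIV. f k) = (\<Sum>i\<in>UNIV. f (Inl i)) + (\<Sum>i\<in>UNIV. f (Inr i))"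
  by (subst UNIV_Plus_UNIV[symmetric], subst sum.Plus) auto

lemma has_vector_derivative_velocity:
  "c differentiable (at t) \<Longrightarrow> (c has_vector_derivative velocity c t) (at t)"
  by (simp add: velocity_def vector_derivative_works)

lemma velocity_eqI: "(c has_vector_derivative v) (at t) \<Longrightarrow> velocity c t = v"
  by (simp add: velocity_def vector_derivative_at)

lemma has_vector_derivative_nth:
  fixes X :: "real \<Rightarrow> real ^ 'n::finite"
  assumes "(X has_vector_derivative V) F"
  shows "((\<lambda>t. X t $ i) has_vector_derivative V $ i) F"
  using bounded_linear.has_vector_derivative[OF bounded_linear_vec_nth assms] .

text \<open>The chain rule in coordinates: each \<open>partial_deriv\<close> is the total derivative
  applied to a basis vector, and expanding \<open>v\<close> in the basis gives the sum. It is used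
  for metric coefficients along a curve.\<close>

lemma has_real_derivative_along_curve:
  fixes f :: "real ^ 'n::finite \<Rightarrow> real"
  assumes f: "f differentiable (at (c t))" and c: "(c has_vector_derivative v) (at t)"
  shows "((\<lambda>s. f (c s)) has_real_derivative (\<Sum>k\<in>UNIV. partial_deriv k f (c t) * v $ k)) (at t)"
proof -
  obtain D where D: "(f has_derivative D) (at (c t))"
    using f by (auto simp: differentiable_def)
  then have lin: "linear D" by (rule has_derivative_linear)
  have pd: "partial_deriv k f (c t) = D (axis k 1)" for k
  proof -
    have "((\<lambda>s. c t + s *\<^sub>R axis k 1) has_vector_derivative axis k 1) (at 0)"
      by (auto intro!: derivative_eq_intros)
    from vector_derivative_diff_chain_within[OF this, of f D]
    have "((\<lambda>s. f (c t + s *\<^sub>R axis k 1)) has_vector_derivative D (axis k 1)) (at 0)"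
      using D by (auto simp: o_def intro: has_derivative_subset)
    then show ?thesis
      unfolding partial_deriv_def
      by (intro DERIV_imp_deriv) (simp add: has_real_derivative_iff_has_vector_derivative)
  qed
  have "D v = D (\<Sum>k\<in>UNIV. v $ k *\<^sub>R axis k 1)"
    using basis_expansion[of v] by (simp add: scalar_mult_eq_scaleR)
  also have "\<dots> = (\<Sum>k\<in>UNIV. partial_deriv k f (c t) * v $ k)"
    by (simp add: linear_sum[OF lin] linear_cmul[OF lin] pd mult.commute)
  finally have Dv: "D v = \<dots>" .
  have "((\<lambda>s. f (c s)) has_vector_derivative D v) (at t)"
    using vector_derivative_diff_chain_within[OF c, of f D] D
    by (auto simp: o_def intro: has_derivative_subset)
  then show ?thesis by (simp add: Dv has_real_derivative_iff_has_vector_derivative)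
qed

section \<open>Riemannian metrics in a chart and parallel fields\<close>

locale riemannian_chart =
  fixes g :: "'n::finite metric"
  assumes bilinear: "bilinear (g p)"
    and symmetric: "g p v w = g p w v"
    and positive: "v \<noteq> 0 \<Longrightarrow> 0 < g p v v"
begin

lemma zero_left [simp]: "g p 0 w = 0" and zero_right [simp]: "g p w 0 = 0"
  using bilinear[of p] by (simp_all add: bilinear_lzero bilinear_rzero)

lemma eq_sum_metric_matrix:
  "g p v w = (\<Sum>i\<in>UNIV. \<Sum>j\<in>UNIV. metric_matrix g p $ i $ j * v $ i * w $ j)"
proof -
  have "g p v w = g p (\<Sum>i\<in>UNIV. v $ i *\<^sub>R axis i 1) (\<Sum>j\<in>UNIV. w $ j *\<^sub>R axis j 1)"
    using basis_expansion[of v] basis_expansion[of w] by (simp add: scalar_mult_eq_scaleR)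
  also have "\<dots> = (\<Sum>i\<in>UNIV. \<Sum>j\<in>UNIV. g p (v $ i *\<^sub>R axis i 1) (w $ j *\<^sub>R axis j 1))"
    by (simp add: bilinear_sum[OF bilinear] sum.cartesian_product)
  finally show ?thesis
    by (simp add: bilinear_lmul[OF bilinear] bilinear_rmul[OF bilinear] metric_matrix_def
        mult.assoc mult.commute)
qed

lemma metric_matrix_symmetric: "metric_matrix g p $ i $ j = metric_matrix g p $ j $ i"
  by (simp add: metric_matrix_def symmetric)

text \<open>A kernel vector \<open>x\<close> satisfies \<open>g p x x = 0\<close>, because this
  number pairs \<open>x\<close> with its image under the matrix; definiteness then gives
  \<open>x = 0\<close>.\<close>

lemma invertible_metric_matrix: "invertible (metric_matrix g p)"
  unfolding invertible_left_inverse matrix_left_invertible_ker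
proof (intro allI impI)
  fix x assume *: "metric_matrix g p *v x = 0"
  have "g p x x = (\<Sum>i\<in>UNIV. x $ i * (metric_matrix g p *v x) $ i)"
    by (subst eq_sum_metric_matrix) (simp add: matrix_vector_mult_def sum_distrib_left ac_simps)
  then have "g p x x = 0" by (simp add: *)
  then show "x = 0" using positive[of x p] by fastforce
qed

text \<open>Lowering the upper index gives the Christoffel symbols of the first kind, which no
  longer contain the inverse matrix.\<close>

lemma metric_matrix_christoffel:
  "(\<Sum>i\<in>UNIV. metric_matrix g p $ l $ i * christoffel g p i h j) =
     (1 / 2) * (partial_deriv h (\<lambda>q. metric_matrix g q $ l $ j) p
        + partial_deriv j (\<lambda>q. metric_matrix g q $ l $ h) p
        - partial_deriv l (\<lambda>q. metric_matrix g q $ h $ j) p)"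
proof -
  let ?G = "metric_matrix g p"
  define b where "b = (\<chi> k. (1 / 2) * (partial_deriv h (\<lambda>q. metric_matrix g q $ k $ j) p
        + partial_deriv j (\<lambda>q. metric_matrix g q $ k $ h) p
        - partial_deriv k (\<lambda>q. metric_matrix g q $ h $ j) p))"
  have "christoffel g p i h j = (matrix_inv ?G *v b) $ i" for i
    by (simp add: christoffel_def b_def matrix_vector_mult_def sum_distrib_left ac_simps)
  then have "(\<Sum>i\<in>UNIV. ?G $ l $ i * christoffel g p i h j) = (?G *v (matrix_inv ?G *v b)) $ l"
    by (simp add: matrix_vector_mult_def[of ?G])
  also have "\<dots> = b $ l"
    by (simp add: matrix_vector_mul_assoc matrix_inv_mul[OF invertible_metric_matrix])
  finally show ?thesis by (simp add: b_def)
qed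

text \<open>Metric compatibility of the Levi-Civita connection, in coordinates: the squared norm of
  \<open>X\<close> has derivative zero at each point of the interval \<open>I\<close>.\<close>

lemma parallel_norm_constant:
  assumes smooth: "\<And>i j p. (\<lambda>q. metric_matrix g q $ i $ j) differentiable (at p)"
    and I: "open I" "is_interval I"
    and C: "\<And>t. t \<in> I \<Longrightarrow> C differentiable (at t)"
    and X: "parallel_along g I C X"
    and st: "s \<in> I" "t \<in> I"
  shows "g (C s) (X s) (X s) = g (C t) (X t) (X t)"
proof -
  have "((\<lambda>t. g (C t) (X t) (X t)) has_real_derivative 0) (at t)" if "t \<in> I" for t
  proof -
    let ?G = "metric_matrix g (C t)" and ?V = "velocity C t" and ?X = "X t"
    let ?\<Gamma> = "christoffel g (C t)"
    let ?d = "\<lambda>k i j. partial_deriv k (\<lambda>q. metric_matrix g q $ i $ j) (C t)"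
    define A where "A = velocity X t"
    have C': "(C has_vector_derivative ?V) (at t)"
      using C[OF that] by (rule has_vector_derivative_velocity)
    have X': "((\<lambda>s. X s $ i) has_real_derivative A $ i) (at t)" for i
      using X that unfolding parallel_along_def has_real_derivative_iff_has_vector_derivative A_def
      by (auto intro!: has_vector_derivative_nth has_vector_derivative_velocity)
    have A: "A $ i = - (\<Sum>h\<in>UNIV. \<Sum>k\<in>UNIV. ?\<Gamma> i h k * ?X $ h * ?V $ k)" for i
    proof -
      have "covariant_deriv g C X t $ i = 0" using X that by (simp add: parallel_along_def)
      then show ?thesis by (simp add: covariant_deriv_def A_def)
    qed
    \<comment> \<open>Moving the sum over \<open>i\<close> innermost lets
      \<open>metric_matrix_christoffel\<close> replace the contracted symbols by derivatives of the
      metric.\<close>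
    have GA: "(\<Sum>i\<in>UNIV. ?G $ j $ i * A $ i) =
        - (\<Sum>h\<in>UNIV. \<Sum>k\<in>UNIV. (1 / 2) * (?d h j k + ?d k j h - ?d j h k) * ?X $ h * ?V $ k)" for j
    proof -
      have "(\<Sum>i\<in>UNIV. ?G $ j $ i * A $ i) =
          - (\<Sum>i\<in>UNIV. \<Sum>h\<in>UNIV. \<Sum>k\<in>UNIV. ?G $ j $ i * ?\<Gamma> i h k * ?X $ h * ?V $ k)"
        by (simp only: A sum_distrib_left sum_negf mult_minus_right mult.assoc)
      also have "(\<Sum>i\<in>UNIV. \<Sum>h\<in>UNIV. \<Sum>k\<in>UNIV. ?G $ j $ i * ?\<Gamma> i h k * ?X $ h * ?V $ k)
          = (\<Sum>h\<in>UNIV. \<Sum>i\<in>UNIV. \<Sum>k\<in>UNIV. ?G $ j $ i * ?\<Gamma> i h k * ?X $ h * ?V $ k)"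
        by (rule sum.swap)
      also have "\<dots> = (\<Sum>h\<in>UNIV. \<Sum>k\<in>UNIV. \<Sum>i\<in>UNIV. ?G $ j $ i * ?\<Gamma> i h k * ?X $ h * ?V $ k)"
        by (intro sum.cong refl sum.swap)
      also have "\<dots> = (\<Sum>h\<in>UNIV. \<Sum>k\<in>UNIV. (\<Sum>i\<in>UNIV. ?G $ j $ i * ?\<Gamma> i h k) * ?X $ h * ?V $ k)"
        by (simp only: sum_distrib_right)
      finally show ?thesis by (simp only: metric_matrix_christoffel)
    qed
    \<comment> \<open>The squared norm has derivative \<open>S + B + B\<close>: \<open>S\<close>
      comes from the metric coefficients and each \<open>B\<close> from one factor \<open>X\<close>.
      \<open>T\<close> names the two Christoffel terms that cancel because
      \<open>?X $ h * ?X $ j\<close> is symmetric in \<open>h\<close> and \<open>j\<close>; what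
      remains of \<open>B\<close> is minus half of \<open>S\<close>.\<close>
    define S where "S = (\<Sum>i\<in>UNIV. \<Sum>j\<in>UNIV. \<Sum>k\<in>UNIV. ?d k i j * ?V $ k * ?X $ i * ?X $ j)"
    define B where "B = (\<Sum>i\<in>UNIV. \<Sum>j\<in>UNIV. ?G $ i $ j * ?X $ i * A $ j)"
    define T where "T = (\<Sum>j\<in>UNIV. \<Sum>h\<in>UNIV. \<Sum>k\<in>UNIV. ?d j h k * ?X $ h * ?V $ k * ?X $ j)"
    have B1: "(\<Sum>i\<in>UNIV. \<Sum>j\<in>UNIV. ?G $ i $ j * A $ i * ?X $ j) = B"
      unfolding B_def
      by (subst sum.swap, intro sum.cong refl)
        (subst metric_matrix_symmetric, simp)
    have T1: "(\<Sum>j\<in>UNIV. \<Sum>h\<in>UNIV. \<Sum>k\<in>UNIV. ?d h j k * ?X $ h * ?V $ k * ?X $ j) = T"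
      unfolding T_def by (subst sum.swap, intro sum.cong refl) simp
    have S1: "(\<Sum>j\<in>UNIV. \<Sum>h\<in>UNIV. \<Sum>k\<in>UNIV. ?d k j h * ?X $ h * ?V $ k * ?X $ j) = S"
      unfolding S_def by (intro sum.cong refl) simp
    have "B = (\<Sum>j\<in>UNIV. ?X $ j * (\<Sum>i\<in>UNIV. ?G $ j $ i * A $ i))"
      by (simp add: B_def sum_distrib_left mult.left_commute mult.assoc)
    also have "\<dots> = - (1 / 2) * (\<Sum>j\<in>UNIV. \<Sum>h\<in>UNIV. \<Sum>k\<in>UNIV.
        ?d h j k * ?X $ h * ?V $ k * ?X $ j + ?d k j h * ?X $ h * ?V $ k * ?X $ j
        - ?d j h k * ?X $ h * ?V $ k * ?X $ j)"
      unfolding GA sum_distrib_left sum_negf[symmetric]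
      by (intro sum.cong refl) (simp add: field_simps)
    also have "\<dots> = - (1 / 2) * (T + S - T)"
      by (simp only: sum.distrib sum_subtractf T1 S1 T_def)
    finally have B2: "S + B + B = 0" by simp
    have fe: "(\<lambda>t. g (C t) (X t) (X t)) =
        (\<lambda>t. \<Sum>i\<in>UNIV. \<Sum>j\<in>UNIV. metric_matrix g (C t) $ i $ j * X t $ i * X t $ j)"
      by (intro ext eq_sum_metric_matrix)
    have "((\<lambda>t. g (C t) (X t) (X t)) has_real_derivative
        (\<Sum>i\<in>UNIV. \<Sum>j\<in>UNIV. (\<Sum>k\<in>UNIV. ?d k i j * ?V $ k) * ?X $ i * ?X $ j
           + ?G $ i $ j * A $ i * ?X $ j + ?G $ i $ j * ?X $ i * A $ j)) (at t)"
    proof (subst fe, intro DERIV_sum)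
      fix i j
      have G': "((\<lambda>t. metric_matrix g (C t) $ i $ j) has_real_derivative
          (\<Sum>k\<in>UNIV. ?d k i j * ?V $ k)) (at t)"
        by (rule has_real_derivative_along_curve[OF smooth C'])
      show "((\<lambda>t. metric_matrix g (C t) $ i $ j * X t $ i * X t $ j) has_real_derivative
          (\<Sum>k\<in>UNIV. ?d k i j * ?V $ k) * ?X $ i * ?X $ j
           + ?G $ i $ j * A $ i * ?X $ j + ?G $ i $ j * ?X $ i * A $ j) (at t)"
        by (rule DERIV_cong[OF DERIV_mult[OF DERIV_mult[OF G' X'] X']]) (simp only: ring_distribs ac_simps)
    qed
    moreover have "(\<Sum>i\<in>UNIV. \<Sum>j\<in>UNIV. (\<Sum>k\<in>UNIV. ?d k i j * ?V $ k) * ?X $ i * ?X $ j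
           + ?G $ i $ j * A $ i * ?X $ j + ?G $ i $ j * ?X $ i * A $ j) = S + B + B"
      by (simp only: sum.distrib sum_distrib_right B1) (simp only: S_def B_def)
    ultimately show ?thesis using B2 by simp
  qed
  then have "\<exists>c. \<forall>t\<in>I. g (C t) (X t) (X t) = c"
    using I(2) by (intro has_field_derivative_zero_constant)
      (auto simp: is_interval_convex_1 intro: has_field_derivative_at_within)
  then show ?thesis using st by auto
qed

text \<open>The constant squared norm is zero at \<open>s\<close>, and the metric is
  definite.\<close>

lemma parallel_zero:
  assumes "\<And>i j p. (\<lambda>q. metric_matrix g q $ i $ j) differentiable (at p)"
    and "open I" "is_interval I"
    and "\<And>t. t \<in> I \<Longrightarrow> C differentiable (at t)"
    and "parallel_along g I C X"
    and "s \<in> I" "X s = 0" "t \<in> I"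
  shows "X t = 0"
proof -
  have "g (C t) (X t) (X t) = 0"
    using parallel_norm_constant[OF assms(1-6,8)] assms(7) by simp
  then show ?thesis using positive[of "X t" "C t"] by fastforce
qed

end

section \<open>Coordinates on the tangent bundle and curves in the zero section\<close>

lemma bundle_pair_Inl [simp]: "bundle_pair x y $ Inl i = x $ i"
  and bundle_pair_Inr [simp]: "bundle_pair x y $ Inr i = y $ i"
  by (simp_all add: bundle_pair_def)

lemma base_part_nth [simp]: "base_part p $ i = p $ Inl i"
  and fibre_part_nth [simp]: "fibre_part p $ i = p $ Inr i"
  by (simp_all add: base_part_def fibre_part_def)

lemma vec_sum_eq_iff:
  fixes p q :: "'a ^ ('m::finite + 'n::finite)"
  shows "p = q \<longleftrightarrow> (\<forall>i. p $ Inl i = q $ Inl i) \<and> (\<forall>i. p $ Inr i = q $ Inr i)"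
  by (auto simp: vec_eq_iff split_sum_all)

lemma base_part_bundle_pair [simp]: "base_part (bundle_pair x y) = x"
  and fibre_part_bundle_pair [simp]: "fibre_part (bundle_pair x y) = y"
  and bundle_pair_parts [simp]: "bundle_pair (base_part p) (fibre_part p) = p"
  and bundle_pair_0 [simp]: "bundle_pair 0 0 = 0"
  by (simp_all add: vec_eq_iff[of "base_part _"] vec_eq_iff[of "fibre_part _"] vec_sum_eq_iff)

lemma bundle_pair_eq_iff: "bundle_pair x y = bundle_pair x' y' \<longleftrightarrow> x = x' \<and> y = y'"
  by (metis base_part_bundle_pair fibre_part_bundle_pair)

lemma bundle_pair_eq_0_iff: "bundle_pair x y = 0 \<longleftrightarrow> x = 0 \<and> y = 0"
  by (metis bundle_pair_0 bundle_pair_eq_iff)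

lemma base_part_axis [simp]: "base_part (axis (Inl i) a) = axis i a" "base_part (axis (Inr i) a) = 0"
  and fibre_part_axis [simp]: "fibre_part (axis (Inr i) a) = axis i a" "fibre_part (axis (Inl i) a) = 0"
  by (simp_all add: vec_eq_iff axis_def)

lemma linear_base_part: "linear base_part"
  by (auto intro!: linearI simp: vec_eq_iff)

lemma linear_connection_form: "linear (connection_form g p)"
  by (auto intro!: linearI simp: vec_eq_iff connection_form_def ring_distribs sum.distrib
      sum_distrib_left mult.left_commute)

text \<open>On horizontal coordinate vectors the form \<open>Dy\<close> is linear in the fibre
  point. Hence, along a fibre line through the zero section, the base block of the Sasaki metric is
  a constant plus a multiple of the squared parameter.\<close>

lemma connection_form_base_scaleR:
  "connection_form g (bundle_pair x (s *\<^sub>R y)) (bundle_pair v 0) =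
    s *\<^sub>R connection_form g (bundle_pair x y) (bundle_pair v 0)"
  by (simp add: vec_eq_iff connection_form_def sum_distrib_left ac_simps)

lemma connection_form_zero_section: "connection_form g (bundle_pair x 0) V = fibre_part V"
  by (simp add: vec_eq_iff connection_form_def)

lemma connection_form_vertical: "base_part V = 0 \<Longrightarrow> connection_form g p V = fibre_part V"
  by (simp add: vec_eq_iff connection_form_def)

lemma axis_Inl: "axis (Inl i) a = bundle_pair (axis i a) 0"
  and axis_Inr: "axis (Inr i) a = bundle_pair 0 (axis i a)"
  by (simp_all add: vec_sum_eq_iff axis_def)

lemma partial_deriv_Inl:
  "partial_deriv (Inl k) f (bundle_pair x y) = partial_deriv k (\<lambda>x. f (bundle_pair x y)) x"
proof -
  have "bundle_pair x y + s *\<^sub>R axis (Inl k) 1 = bundle_pair (x + s *\<^sub>R axis k 1) y" for s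
    by (simp add: vec_sum_eq_iff axis_Inl)
  then show ?thesis by (simp add: partial_deriv_def)
qed

lemma partial_deriv_Inr:
  "partial_deriv (Inr k) f (bundle_pair x y) = partial_deriv k (\<lambda>y. f (bundle_pair x y)) y"
proof -
  have "bundle_pair x y + s *\<^sub>R axis (Inr k) 1 = bundle_pair x (y + s *\<^sub>R axis k 1)" for s
    by (simp add: vec_sum_eq_iff axis_Inr)
  then show ?thesis by (simp add: partial_deriv_def)
qed

lemma partial_deriv_const [simp]: "partial_deriv k (\<lambda>_. a) p = 0"
  by (simp add: partial_deriv_def)

text \<open>Reads a partial derivative off the expansion along one coordinate line. The Sasaki base
  block at \<open>y = 0\<close> is a case with \<open>b = 0\<close>; the Heisenberg coefficients are
  also quadratic along each coordinate line.\<close>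

lemma partial_deriv_quadratic:
  assumes "\<And>s. f (p + s *\<^sub>R axis k 1) = a + b * s + c * s\<^sup>2"
  shows "partial_deriv k f p = b"
  unfolding partial_deriv_def assms
  by (rule DERIV_imp_deriv) (auto intro!: derivative_eq_intros)

lemma has_vector_derivative_bundle_pair_0:
  assumes "(c has_vector_derivative v) F"
  shows "((\<lambda>t. bundle_pair (c t) 0) has_vector_derivative bundle_pair v 0) F"
proof -
  have "linear (\<lambda>x. bundle_pair x 0)"
    by (auto intro!: linearI simp: vec_sum_eq_iff)
  then show ?thesis
    by (intro bounded_linear.has_vector_derivative[OF _ assms]) (simp add: linear_conv_bounded_linear)
qed

lemma has_vector_derivative_base_part:
  assumes "(L has_vector_derivative V) F"
  shows "((\<lambda>t. base_part (L t)) has_vector_derivative base_part V) F"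
  by (intro bounded_linear.has_vector_derivative[OF _ assms])
    (simp add: linear_base_part flip: linear_conv_bounded_linear)

text \<open>\<open>L\<close> agrees with \<open>(C, 0)\<close> only on \<open>I\<close>; since
  \<open>I\<close> is open, this fixes all two-sided derivatives at its points. All orders occur
  because \<open>geodesic_on\<close> includes smoothness.\<close>

lemma velocity_funpow_zero_section:
  assumes "open I" "smooth_curve_on I C"
    and L: "\<And>t. t \<in> I \<Longrightarrow> L t = bundle_pair (C t) 0"
    and "t \<in> I"
  shows "(velocity ^^ k) L t = bundle_pair ((velocity ^^ k) C t) 0 \<and>
    (velocity ^^ k) L differentiable (at t)"
  using \<open>t \<in> I\<close>
proof (induction k arbitrary: t)
  \<comment> \<open>Stated for arbitrary \<open>M\<close>, so that it applies to every iterated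
    velocity of \<open>L\<close>: agreement on all of \<open>I\<close> at one order yields the
    derivative, and so the next order.\<close>
  have deriv: "(M has_vector_derivative bundle_pair (velocity ((velocity ^^ k) C) t) 0) (at t)"
    if "t \<in> I" "\<And>t. t \<in> I \<Longrightarrow> M t = bundle_pair ((velocity ^^ k) C t) 0" for M k t
  proof (rule has_vector_derivative_transform_within_open)
    show "((\<lambda>t. bundle_pair ((velocity ^^ k) C t) 0) has_vector_derivative
        bundle_pair (velocity ((velocity ^^ k) C) t) 0) (at t)"
      using assms(2) that(1) unfolding smooth_curve_on_def
      by (intro has_vector_derivative_bundle_pair_0 has_vector_derivative_velocity) auto
  qed (use that \<open>open I\<close> in auto)
  {
    case 0
    then show ?case using deriv[of t L 0] L by (auto intro: differentiableI_vector)
  next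
    case (Suc k)
    have *: "(velocity ^^ Suc k) L t = bundle_pair ((velocity ^^ Suc k) C t) 0" if "t \<in> I" for t
      using deriv[OF that, of "(velocity ^^ k) L" k] Suc.IH by (simp add: velocity_eqI)
    then show ?case
      using deriv[OF Suc.prems, of "(velocity ^^ Suc k) L" "Suc k"] Suc.prems
      by (auto intro: differentiableI_vector)
  }
qed

section \<open>The Sasaki metric and its Christoffel symbols on the zero section\<close>

context riemannian_chart
begin

text \<open>Makes the results on parallel fields available on the bundle. For definiteness, a
  nonzero base part makes the first summand positive; for a vertical vector the connection form is
  the fibre part, which is then nonzero.\<close>

lemma riemannian_chart_sasaki: "riemannian_chart (sasaki_metric g)"
proof
  fix p V W :: "real ^ ('n + 'n)"
  note add = linear_add[OF linear_base_part] linear_add[OF linear_connection_form]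
  note cmul = linear_cmul[OF linear_base_part] linear_cmul[OF linear_connection_form]
  show "bilinear (sasaki_metric g p)"
    unfolding bilinear_def
    by (auto intro!: linearI simp: sasaki_metric_def add cmul bilinear_ladd[OF bilinear]
        bilinear_radd[OF bilinear] bilinear_lmul[OF bilinear] bilinear_rmul[OF bilinear]
        ring_distribs)
  show "sasaki_metric g p V W = sasaki_metric g p W V"
    by (simp add: sasaki_metric_def symmetric)
  assume "V \<noteq> 0"
  have nonneg: "0 \<le> g q v v" for q v
    using positive[of v q] by (cases "v = 0") auto
  show "0 < sasaki_metric g p V V"
  proof (cases "base_part V = 0")
    case True
    then have "fibre_part V \<noteq> 0"
      using \<open>V \<noteq> 0\<close> bundle_pair_parts[of V] by fastforce
    then show ?thesis
      using True positive by (simp add: sasaki_metric_def connection_form_vertical)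
  next
    case False
    then show ?thesis
      using positive nonneg by (simp add: sasaki_metric_def add_pos_nonneg)
  qed
qed

lemma sasaki_matrix_zero_section:
  "metric_matrix (sasaki_metric g) (bundle_pair x 0) $ Inl i $ Inl j = metric_matrix g x $ i $ j"
  "metric_matrix (sasaki_metric g) (bundle_pair x 0) $ Inr i $ Inr j = metric_matrix g x $ i $ j"
  "metric_matrix (sasaki_metric g) (bundle_pair x 0) $ Inl i $ Inr j = 0"
  "metric_matrix (sasaki_metric g) (bundle_pair x 0) $ Inr i $ Inl j = 0"
  by (simp_all add: metric_matrix_def sasaki_metric_def connection_form_zero_section)

lemma sasaki_matrix_inv_zero_section:
  "matrix_inv (metric_matrix (sasaki_metric g) (bundle_pair x 0)) $ Inl i $ Inl j =
     matrix_inv (metric_matrix g x) $ i $ j"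
  "matrix_inv (metric_matrix (sasaki_metric g) (bundle_pair x 0)) $ Inl i $ Inr j = 0"
  "matrix_inv (metric_matrix (sasaki_metric g) (bundle_pair x 0)) $ Inr i $ Inl j = 0"
proof -
  let ?M = "metric_matrix (sasaki_metric g) (bundle_pair x 0)" and ?G = "metric_matrix g x"
  \<comment> \<open>The block diagonal candidate with two copies of the inverse of
    \<open>?G\<close>; uniqueness of inverses identifies it.\<close>
  define N :: "real ^ ('n + 'n) ^ ('n + 'n)" where
    "N = (\<chi> a b. case (a, b) of (Inl i, Inl j) \<Rightarrow> matrix_inv ?G $ i $ j
       | (Inr i, Inr j) \<Rightarrow> matrix_inv ?G $ i $ j | _ \<Rightarrow> 0)"
  have "(\<Sum>k\<in>UNIV. ?G $ i $ k * matrix_inv ?G $ k $ j) = mat 1 $ i $ j" for i j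
    using matrix_inv_mul(1)[OF invertible_metric_matrix, of x]
    by (simp add: matrix_matrix_mult_def vec_eq_iff)
  then have "?M ** N = mat 1"
    by (simp add: vec_sum_eq_iff[where 'a=real] vec_sum_eq_iff[where 'a="real ^ ('n + 'n)"]
        matrix_matrix_mult_def sum_UNIV_sum_type sasaki_matrix_zero_section N_def mat_def)
  then have "matrix_inv ?M = N" by (rule matrix_inv_unique)
  then show "matrix_inv ?M $ Inl i $ Inl j = matrix_inv (metric_matrix g x) $ i $ j"
    "matrix_inv ?M $ Inl i $ Inr j = 0" "matrix_inv ?M $ Inr i $ Inl j = 0"
    by (simp_all add: N_def)
qed

text \<open>Holds because the base block of the Sasaki metric is even in the fibre coordinates.\<close>

lemma sasaki_fibre_deriv_zero_section:
  "partial_deriv (Inr k) (\<lambda>q. metric_matrix (sasaki_metric g) q $ Inl i $ Inl j) (bundle_pair x 0) = 0"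
  unfolding partial_deriv_Inr
  by (rule partial_deriv_quadratic[where a = "metric_matrix g x $ i $ j" and
        c = "g x (connection_form g (bundle_pair x (axis k 1)) (axis (Inl i) 1))
          (connection_form g (bundle_pair x (axis k 1)) (axis (Inl j) 1))"])
    (simp add: metric_matrix_def sasaki_metric_def axis_Inl connection_form_base_scaleR
      bilinear_lmul[OF bilinear] bilinear_rmul[OF bilinear] power2_eq_square)

text \<open>The inverse is block diagonal, so the upper index selects one block. Base derivatives
  stay on the zero section, where the base block is that of \<open>g\<close> and the mixed blocks
  vanish; fibre derivatives of the base block are zero. Lower indices \<open>Inl\<close> suffice for
  curves whose velocity has no fibre part.\<close>

lemma sasaki_christoffel_zero_section:
  "christoffel (sasaki_metric g) (bundle_pair x 0) (Inl i) (Inl h) (Inl j) = christoffel g x i h j"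
  "christoffel (sasaki_metric g) (bundle_pair x 0) (Inr i) (Inl h) (Inl j) = 0"
  by (simp_all add: christoffel_def sum_UNIV_sum_type sasaki_matrix_inv_zero_section
      partial_deriv_Inl sasaki_matrix_zero_section sasaki_fibre_deriv_zero_section)

text \<open>The covariant acceleration of \<open>(C, 0)\<close> is that of \<open>C\<close> in the
  base and zero in the fibre. Requiring agreement on \<open>I\<close> only makes this applicable to
  both kinds of lift.\<close>

lemma geodesic_zero_section_iff:
  assumes "open I" "smooth_curve_on I C"
    and L: "\<And>t. t \<in> I \<Longrightarrow> L t = bundle_pair (C t) 0"
  shows "geodesic_on (sasaki_metric g) I L \<longleftrightarrow> geodesic_on g I C"
proof -
  have vel: "(velocity ^^ k) L t = bundle_pair ((velocity ^^ k) C t) 0 \<and>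
      (velocity ^^ k) L differentiable (at t)" if "t \<in> I" for k t
    using assms that by (rule velocity_funpow_zero_section)
  have smooth: "smooth_curve_on I L"
    using vel unfolding smooth_curve_on_def by blast
  have "covariant_deriv (sasaki_metric g) L (velocity L) t =
      bundle_pair (covariant_deriv g C (velocity C) t) 0" if "t \<in> I" for t
    \<comment> \<open>The first iterate is the velocity of \<open>L\<close> and the second its
      derivative; both have zero fibre part.\<close>
    using vel[OF that, of "Suc 0"] vel[OF that, of "Suc (Suc 0)"]
    by (simp add: vec_sum_eq_iff covariant_deriv_def sum_UNIV_sum_type L[OF that]
        sasaki_christoffel_zero_section)
  then have "parallel_along (sasaki_metric g) I L (velocity L) \<longleftrightarrow> parallel_along g I C (velocity C)"
    using vel[of _ "Suc 0"] assms(2)[unfolded smooth_curve_on_def, rule_format, of _ "Suc 0"]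
    by (auto simp: parallel_along_def bundle_pair_eq_0_iff)
  then show ?thesis using smooth assms(2) by (simp add: geodesic_on_def)
qed

lemma metric_differentiable:
  fixes x v w :: "'b::real_normed_vector \<Rightarrow> real ^ 'n"
  assumes smooth: "\<And>i j p. (\<lambda>q. metric_matrix g q $ i $ j) differentiable (at p)"
    and "x differentiable (at q)"
    and "\<And>i. (\<lambda>q. v q $ i) differentiable (at q)" "\<And>i. (\<lambda>q. w q $ i) differentiable (at q)"
  shows "(\<lambda>q. g (x q) (v q) (w q)) differentiable (at q)"
proof -
  have "(\<lambda>q. g (x q) (v q) (w q)) =
      (\<lambda>q. \<Sum>i\<in>UNIV. \<Sum>j\<in>UNIV. metric_matrix g (x q) $ i $ j * v q $ i * w q $ j)"
    by (intro ext eq_sum_metric_matrix)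
  then show ?thesis
    using assms(2-) by (simp add: differentiable_compose[OF smooth])
qed

text \<open>The Christoffel symbols of \<open>g\<close> enter the Sasaki coefficients through
  \<open>connection_form\<close>, hence the second hypothesis. The result covers the whole bundle,
  because a geodesic natural lift is not known in advance to lie in the zero section.\<close>

lemma sasaki_matrix_differentiable:
  assumes smooth: "\<And>i j p. (\<lambda>q. metric_matrix g q $ i $ j) differentiable (at p)"
    and christoffel: "\<And>i h j p. (\<lambda>q. christoffel g q i h j) differentiable (at p)"
  shows "(\<lambda>q. metric_matrix (sasaki_metric g) q $ a $ b) differentiable (at p)"
proof -
  have base: "base_part differentiable (at p)"
    using linear_base_part
    by (intro bounded_linear_imp_differentiable) (simp add: linear_conv_bounded_linear)
  have fibre: "(\<lambda>q. fibre_part q $ h) differentiable (at p)" for h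
    by (simp add: bounded_linear_imp_differentiable bounded_linear_vec_nth)
  have "(\<lambda>q. connection_form g q V $ i) differentiable (at p)" for V i
    using differentiable_compose[OF christoffel base] fibre by (simp add: connection_form_def)
  then show ?thesis
    using base unfolding metric_matrix_def sasaki_metric_def
    by (simp add: metric_differentiable[OF smooth])
qed

end


section \<open>The Heisenberg metric and the regularity of its coefficients\<close>

lemma heisenberg_form_linear:
  "heisenberg_form x (v + w) = heisenberg_form x v + heisenberg_form x w"
  "heisenberg_form x (a *\<^sub>R v) = a * heisenberg_form x v"
  by (simp_all add: heisenberg_form_def algebra_simps)

lemma heisenberg_form_translate:
  "heisenberg_form (x + s *\<^sub>R e) v = heisenberg_form x v + s * (e $ 2 * v $ 1 - e $ 1 * v $ 2)"
  by (simp add: heisenberg_form_def algebra_simps)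

lemma heisenberg_form_differentiable: "(\<lambda>x. heisenberg_form x v) differentiable (at p)"
  unfolding heisenberg_form_def
  by (simp add: bounded_linear_imp_differentiable bounded_linear_vec_nth)

interpretation heisenberg: riemannian_chart heisenberg_metric
proof
  fix p v w :: "real ^ 3"
  show "bilinear (heisenberg_metric p)"
    unfolding bilinear_def
    by (auto intro!: linearI simp: heisenberg_metric_def heisenberg_form_linear algebra_simps)
  show "heisenberg_metric p v w = heisenberg_metric p w v"
    by (simp add: heisenberg_metric_def)
  assume "v \<noteq> 0"
  show "0 < heisenberg_metric p v v"
  \<comment> \<open>If the first two components vanish, the one-form reduces to the third; otherwise
    the first two squares already have a positive sum.\<close>
  proof (cases "v $ 1 = 0 \<and> v $ 2 = 0")
    case True
    then have "v $ 3 \<noteq> 0" using \<open>v \<noteq> 0\<close> by (simp add: vec_eq_iff forall_3)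
    then have "0 < v $ 3 * v $ 3" by (simp add: zero_less_mult_iff) linarith
    then show ?thesis using True by (simp add: heisenberg_metric_def heisenberg_form_def)
  next
    case False
    then have "0 < v $ 1 * v $ 1 + v $ 2 * v $ 2"
      using sum_squares_gt_zero_iff by blast
    then show ?thesis by (simp add: heisenberg_metric_def add_pos_nonneg)
  qed
qed

lemma heisenberg_matrix_differentiable:
  "(\<lambda>q. metric_matrix heisenberg_metric q $ i $ j) differentiable (at p)"
  by (simp add: metric_matrix_def heisenberg_metric_def heisenberg_form_differentiable)

text \<open>The coframe defining the metric is unimodular, so the metric matrix has determinant one
  and its inverse has polynomial entries.\<close>

lemma heisenberg_matrix_inv:
  "matrix_inv (metric_matrix heisenberg_metric p) =
    vector [vector [1, 0, - p $ 2], vector [0, 1, p $ 1],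
      vector [- p $ 2, p $ 1, 1 + (p $ 1)\<^sup>2 + (p $ 2)\<^sup>2]]"
  by (rule matrix_inv_unique)
    (simp add: vec_eq_iff forall_3 matrix_matrix_mult_def sum_3 mat_def metric_matrix_def
      heisenberg_metric_def heisenberg_form_def axis_def vector_3 algebra_simps power2_eq_square)

text \<open>A coefficient is a constant plus a product of two values of the one-form, each affine
  along a coordinate line. The derivative is the product rule, and the witness \<open>c\<close> is
  the product of the two slopes.\<close>

lemma heisenberg_partial_deriv:
  "partial_deriv k (\<lambda>q. metric_matrix heisenberg_metric q $ i $ j) p =
    heisenberg_form p (axis i 1) * (axis k 1 $ 2 * axis j 1 $ 1 - axis k 1 $ 1 * axis j 1 $ 2)
    + (axis k 1 $ 2 * axis i 1 $ 1 - axis k 1 $ 1 * axis i 1 $ 2) * heisenberg_form p (axis j 1)"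
  by (rule partial_deriv_quadratic[where a = "metric_matrix heisenberg_metric p $ i $ j" and
        c = "(axis k 1 $ 2 * axis i 1 $ 1 - axis k 1 $ 1 * axis i 1 $ 2)
          * (axis k 1 $ 2 * axis j 1 $ 1 - axis k 1 $ 1 * axis j 1 $ 2)"])
    (simp only: metric_matrix_def heisenberg_metric_def heisenberg_form_translate vec_lambda_beta,
      simp add: algebra_simps power2_eq_square)

text \<open>The inverse matrix and the partial derivatives are explicit polynomials in the base
  point.\<close>

lemma heisenberg_christoffel_differentiable:
  "(\<lambda>q. christoffel heisenberg_metric q i h j) differentiable (at p)"
proof -
  have coord: "(\<lambda>q::real ^ 3. q $ m) differentiable (at p)" for m
    by (simp add: bounded_linear_imp_differentiable bounded_linear_vec_nth)
  have "(\<lambda>q. matrix_inv (metric_matrix heisenberg_metric q) $ i $ k) differentiable (at p)" for k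
    using exhaust_3[of i] exhaust_3[of k]
    by (elim disjE) (simp_all add: heisenberg_matrix_inv vector_3 coord)
  then show ?thesis
    unfolding christoffel_def heisenberg_partial_deriv
    by (simp add: heisenberg_form_differentiable)
qed

interpretation sasaki: riemannian_chart "sasaki_metric heisenberg_metric"
  by (rule heisenberg.riemannian_chart_sasaki)

lemma sasaki_heisenberg_matrix_differentiable:
  "(\<lambda>q. metric_matrix (sasaki_metric heisenberg_metric) q $ a $ b) differentiable (at p)"
  by (rule heisenberg.sasaki_matrix_differentiable)
    (rule heisenberg_matrix_differentiable heisenberg_christoffel_differentiable)+

section \<open>Geodesics at rest and the two kinds of lift\<close>

lemma smooth_curve_on_differentiable: "smooth_curve_on I c \<Longrightarrow> t \<in> I \<Longrightarrow> c differentiable (at t)"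
  unfolding smooth_curve_on_def by (metis funpow_0)

text \<open>The velocity of a geodesic is a parallel field along it, so \<open>parallel_zero\<close>
  applies.\<close>

lemma (in riemannian_chart) geodesic_velocity_zero:
  assumes smooth: "\<And>i j p. (\<lambda>q. metric_matrix g q $ i $ j) differentiable (at p)"
    and I: "open I" "is_interval I"
    and C: "geodesic_on g I C" and 0: "s \<in> I" "velocity C s = 0" and "t \<in> I"
  shows "velocity C t = 0"
  using smooth I _ _ 0 \<open>t \<in> I\<close>
proof (rule parallel_zero)
  show "parallel_along g I C (velocity C)" using C by (simp add: geodesic_on_def)
  show "C differentiable (at t)" if "t \<in> I" for t
    using C that by (auto simp: geodesic_on_def intro: smooth_curve_on_differentiable)
qed

theorem theorem4p2:
  fixes I :: "real set" and C :: "real \<Rightarrow> real ^ 3" and u v w :: real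
  assumes "open I" and "is_interval I" and "0 \<in> I"
    and "smooth_curve_on I C"
  shows
    "(\<forall>L. horizontal_lift heisenberg_metric I C L \<longrightarrow>
        L 0 = 0 \<longrightarrow> velocity L 0 = bundle_pair (vector [u, v, w]) 0 \<longrightarrow>
        (geodesic_on (sasaki_metric heisenberg_metric) I L \<longleftrightarrow>
         geodesic_on heisenberg_metric I C))
     \<and>
     (natural_lift C 0 = 0 \<longrightarrow>
        velocity (natural_lift C) 0 = bundle_pair (vector [u, v, w]) 0 \<longrightarrow>
        (geodesic_on (sasaki_metric heisenberg_metric) I (natural_lift C) \<longleftrightarrow>
         geodesic_on heisenberg_metric I C))"
proof (intro conjI allI impI)
  note C = \<open>smooth_curve_on I C\<close>
  fix L
  assume "horizontal_lift heisenberg_metric I C L" and L0: "L 0 = 0"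
  then obtain X where X: "parallel_along heisenberg_metric I C X"
    and L: "\<And>t. t \<in> I \<Longrightarrow> L t = bundle_pair (C t) (X t)"
    unfolding horizontal_lift_def by blast
  have "X 0 = 0"
    using L[OF \<open>0 \<in> I\<close>] L0 bundle_pair_eq_0_iff by metis
  then have "X t = 0" if "t \<in> I" for t
    using heisenberg.parallel_zero[OF heisenberg_matrix_differentiable \<open>open I\<close> \<open>is_interval I\<close>
        smooth_curve_on_differentiable[OF C] X \<open>0 \<in> I\<close> _ that] by simp
  then show "geodesic_on (sasaki_metric heisenberg_metric) I L \<longleftrightarrow> geodesic_on heisenberg_metric I C"
    using L by (intro heisenberg.geodesic_zero_section_iff[OF \<open>open I\<close> C]) simp
next
  note C = \<open>smooth_curve_on I C\<close>
  let ?L = "natural_lift C"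
  assume L0: "?L 0 = 0" and L'0: "velocity ?L 0 = bundle_pair (vector [u, v, w]) 0"
  \<comment> \<open>The fibre part of the natural lift is \<open>velocity C\<close>, so its
    vanishing at 0 means that \<open>C\<close> starts at rest.\<close>
  have C'0: "velocity C 0 = 0"
    using L0 by (simp add: natural_lift_def bundle_pair_eq_0_iff)
  \<comment> \<open>The base part of the lift is \<open>C\<close> itself; the geodesic assumption
    supplies differentiability of the lift.\<close>
  have base: "velocity C t = base_part (velocity ?L t)"
    if "geodesic_on (sasaki_metric heisenberg_metric) I ?L" "t \<in> I" for t
  proof -
    have "?L differentiable (at t)"
      using that by (auto simp: geodesic_on_def intro: smooth_curve_on_differentiable)
    then have "((\<lambda>t. base_part (?L t)) has_vector_derivative base_part (velocity ?L t)) (at t)"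
      by (intro has_vector_derivative_base_part has_vector_derivative_velocity)
    then show ?thesis by (simp add: natural_lift_def velocity_eqI)
  qed
  have zero_section: "geodesic_on (sasaki_metric heisenberg_metric) I ?L \<longleftrightarrow>
      geodesic_on heisenberg_metric I C"
    if "\<And>t. t \<in> I \<Longrightarrow> velocity C t = 0"
    using that
    by (intro heisenberg.geodesic_zero_section_iff[OF \<open>open I\<close> C]) (simp add: natural_lift_def)
  show "geodesic_on (sasaki_metric heisenberg_metric) I ?L \<longleftrightarrow> geodesic_on heisenberg_metric I C"
  proof
    assume geo: "geodesic_on (sasaki_metric heisenberg_metric) I ?L"
    \<comment> \<open>The base part of this velocity is \<open>(u, v, w)\<close>, which
      \<open>base\<close> equates with \<open>velocity C 0\<close>, hence with zero; its fibre part
      is zero by assumption.\<close>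
    then have "velocity ?L 0 = 0"
      using base[OF geo \<open>0 \<in> I\<close>] C'0 L'0 by simp
    then have "velocity ?L t = 0" if "t \<in> I" for t
      using sasaki.geodesic_velocity_zero[OF sasaki_heisenberg_matrix_differentiable \<open>open I\<close>
          \<open>is_interval I\<close> geo \<open>0 \<in> I\<close> _ that] by simp
    then have "velocity C t = 0" if "t \<in> I" for t
      using base[OF geo that] that by (simp add: vec_eq_iff)
    then show "geodesic_on heisenberg_metric I C" using zero_section geo by blast
  next
    assume geo: "geodesic_on heisenberg_metric I C"
    have "velocity C t = 0" if "t \<in> I" for t
      using heisenberg.geodesic_velocity_zero[OF heisenberg_matrix_differentiable \<open>open I\<close>
          \<open>is_interval I\<close> geo \<open>0 \<in> I\<close> C'0 that] .
    then show "geodesic_on (sasaki_metric heisenberg_metric) I ?L" using zero_section geo by blast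
  qed
qed

end
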